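(* Let $$\gamma=\frac12+\frac{\log 12}{2\log 205}=0.7334117\dots.$$ If $x\ge 2$, then there is a set of at least $$\frac{1}{205}\cdot\frac{x^{\gamma}}{\log x}$$ primes contained in $\{1,2,\dots,x\}$ such that the difference between any two distinct primes of the set is never a perfect square.
   Context: $\log$ is the natural logarithm. $\{1,2,\dots,x\}$ denotes the set of positive integers not exceeding $x$. A perfect square is an integer of the form $u^2$ with $u$ an integer. *)

theory Defs
  imports "HOL-Analysis.Analysis" "HOL-Computational_Algebra.Nth_Powers"
begin

definition gamma_exponent :: real where
  "gamma_exponent = 1 / 2 + ln 12 / (2 * ln 205)"

lemma gamma_exponent_decimals: "gamma_exponent \<in> {0.7334117..<0.7334118}"
proof -
  define a b c :: real where "a = ln 2" and "b = ln (3 / 2)" and "c = ln (256 / 205)"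
  have a: "a \<in> {0.6931471805..0.6931471806}"
    using ln_approx_bounds[of 2 11] by (simp add: a_def eval_nat_numeral)
  have b: "b \<in> {0.4054651080..0.4054651082}"
    using ln_approx_bounds[of "3 / 2" 7] by (simp add: b_def eval_nat_numeral)
  have c: "c \<in> {0.2221674653..0.2221674654}"
    using ln_approx_bounds[of "256 / 205" 6] by (simp add: c_def eval_nat_numeral)
  have ln8: "ln (8 :: real) = 3 * a" and ln256: "ln (256 :: real) = 8 * a"
    using ln_realpow[of 2 3] ln_realpow[of 2 8] by (simp_all add: a_def)
  have l12: "ln 12 = 3 * a + b"
    using ln_mult[of 8 "3 / 2"] by (simp add: ln8 b_def)
  have l205: "ln 205 = 8 * a - c"
    using ln_div[of 256 205] by (simp add: ln256 c_def)
  have "8 * a - c > 0"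
    using a c by simp
  then show ?thesis
    using a b c unfolding gamma_exponent_def l12 l205
    by (simp add: field_simps)
qed

end

theory Submission
  imports Defs "HOL-Number_Theory.Number_Theory" "HOL-Computational_Algebra.Squarefree"
begin

text \<open>
  The construction combines a set of residues that avoids square differences modulo a large
  number with an average over its translates.

  Call \<open>A \<subseteq> {0..<N}\<close> square-difference-free modulo \<open>N\<close> if no difference of two distinct elements
  is congruent to a square modulo \<open>N\<close>. Ruzsa's digit construction amplifies such sets: if \<open>m\<close> is
  squarefree and \<open>R\<close> has the property modulo \<open>m\<close>, then the numbers with \<open>2 * k\<close> digits in base \<open>m\<close>
  whose digits at even positions lie in \<open>R\<close>, while those at odd positions are arbitrary, have it
  modulo \<open>m ^ (2 * k)\<close>. Indeed, let two of them differ by a square and look at the lowest digit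
  where they differ. An even position is impossible by the choice of \<open>R\<close>, and at an odd position
  some prime factor of the squarefree \<open>m\<close> would divide the square to an odd power. Lemma
  \<open>square_diff_free_add_digits\<close> is one step of this construction.

  For \<open>m = 205 = 5 * 41\<close> there is a set \<open>R\<close> with 12 elements, which gives \<open>(12 * 205) ^ k\<close> residues
  modulo \<open>N = 205 ^ (2 * k)\<close>. The exponent \<open>\<gamma>\<close> is defined so that this number is \<open>N powr \<gamma>\<close>.

  Translates of such a set avoid square differences as well. When \<open>N \<ge> x\<close>, the primes up to \<open>x\<close> are
  pairwise incongruent modulo \<open>N\<close>, and each of them lies in a fraction \<open>N powr (\<gamma> - 1)\<close> of
  the \<open>N\<close> translates. Some translate therefore contains at least this fraction of the primes up
  to \<open>x\<close> (\<open>ex_subset_no_square_diff\<close>). Choosing \<open>k\<close> minimal gives \<open>N < 205\<^sup>2 * x\<close>, and passing from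
  \<open>N\<close> to \<open>x\<close> in the fraction costs at most the factor \<open>(205\<^sup>2) powr (1 - \<gamma>) = 205 / 12\<close>.
  What remains is a Chebyshev bound: there are at least \<open>(ln 2 / 3) * x / ln x\<close> primes up to \<open>x\<close>,
  and \<open>12 * ln 2 / 3 \<ge> 1\<close>.
\<close>

section \<open>A lower bound of Chebyshev type for the number of primes\<close>

text \<open>
  The numbers \<open>1 / (m * (n choose m))\<close> form Leibniz's harmonic triangle: each of them is a difference
  of two entries to its left, and the leftmost entries are \<open>1 / n\<close>. A common multiple of
  \<open>1, \<dots>, n\<close> clears the denominators of the leftmost entries in the rows up to \<open>n\<close>, and so it
  clears all denominators in these rows.
\<close>

lemma leibniz_triangle_step:
  assumes "1 \<le> m" "m \<le> n"
  shows "1 / (real (Suc m) * real (Suc n choose Suc m))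
       = 1 / (real m * real (n choose m)) - 1 / (real m * real (Suc n choose m))"
proof -
  have pos: "real (n choose m) > 0" "real (Suc n choose m) > 0"
    using assms by (simp_all add: zero_less_binomial)
  have e1: "real (Suc m) * real (Suc n choose Suc m) = real (Suc n) * real (n choose m)"
    using Suc_times_binomial_eq[of n m] by (metis of_nat_mult mult.commute)
  have "(Suc n - m) * (Suc n choose m) = Suc n * (n choose m)"
    using binomial_absorb_comp[of "Suc n" m] by simp
  then have e2: "(real (Suc n) - real m) * real (Suc n choose m) = real (Suc n) * real (n choose m)"
    using assms by (metis of_nat_mult of_nat_diff le_SucI)
  have n: "real (Suc n) > 0" "real m > 0" using assms by simp_all
  define b where "b = real (n choose m)"
  define c where "c = real (Suc n choose m)"
  define N where "N = real (Suc n)"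
  define M where "M = real m"
  have *: "N * (c - b) = M * c"
    using e2 by (simp add: b_def c_def N_def M_def algebra_simps)
  have p: "b > 0" "c > 0" "N > 0" "M > 0"
    using pos n by (simp_all add: b_def c_def N_def M_def)
  have "1 / (M * b) - 1 / (M * c) = (c - b) / (M * b * c)"
    using p by (simp add: field_simps)
  also have "\<dots> = (N * (c - b)) / (N * (M * b * c))"
    using p by simp
  also have "\<dots> = (M * c) / ((N * b) * (M * c))"
    unfolding * by (simp add: mult_ac)
  also have "\<dots> = 1 / (N * b)"
    using p by simp
  finally have "1 / (N * b) = 1 / (M * b) - 1 / (M * c)" ..
  then show ?thesis
    unfolding e1 b_def c_def N_def M_def .
qed

lemma common_multiple_div_leibniz_in_Ints:
  assumes "1 \<le> m" "m \<le> n" and dvd: "\<And>i. 1 \<le> i \<Longrightarrow> i \<le> n \<Longrightarrow> i dvd (D :: nat)"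
  shows "real D / (real m * real (n choose m)) \<in> \<int>"
  using assms
proof (induction m arbitrary: n)
  case 0
  then show ?case by simp
next
  case (Suc m)
  show ?case
  proof (cases "m = 0")
    case True
    then have "n dvd D" using Suc.prems by simp
    then obtain c where "D = n * c" by auto
    then show ?thesis using True Suc.prems by simp
  next
    case False
    obtain k where k: "n = Suc k" using Suc.prems by (cases n) auto
    have "real D / (real m * real (k choose m)) \<in> \<int>"
         "real D / (real m * real (Suc k choose m)) \<in> \<int>"
      using Suc.prems k False by (auto intro!: Suc.IH)
    then have "real D * (1 / (real m * real (k choose m)) - 1 / (real m * real (Suc k choose m))) \<in> \<int>"
      by (simp add: right_diff_distrib)
    moreover have "1 / (real (Suc m) * real (n choose Suc m))
        = 1 / (real m * real (k choose m)) - 1 / (real m * real (Suc k choose m))"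
      unfolding k by (rule leibniz_triangle_step) (use False Suc.prems k in auto)
    ultimately show ?thesis by (metis times_divide_eq_right mult.right_neutral)
  qed
qed

text \<open>
  The denominators in row \<open>n\<close> of Leibniz's triangle have average \<open>2 ^ (n - 1)\<close>, and none of them
  exceeds a common multiple.
\<close>

lemma common_multiple_ge_power_of_2:
  assumes "1 \<le> n" "0 < D" and dvd: "\<And>i. 1 \<le> i \<Longrightarrow> i \<le> n \<Longrightarrow> i dvd (D :: nat)"
  shows "2 ^ (n - 1) \<le> D"
proof -
  have le: "m * (n choose m) \<le> D" if m: "1 \<le> m" "m \<le> n" for m
  proof -
    have pos: "real m * real (n choose m) > 0"
      using m by (simp add: zero_less_binomial)
    obtain z where z: "real D / (real m * real (n choose m)) = of_int z"
      using common_multiple_div_leibniz_in_Ints[OF m dvd] by (auto elim: Ints_cases)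
    have "real D / (real m * real (n choose m)) > 0" using pos assms(2) by simp
    then have "of_int z \<ge> (1 :: real)" unfolding z by simp
    then have "real D \<ge> real m * real (n choose m)"
      using pos unfolding z[symmetric] by (simp add: field_simps)
    then show ?thesis by (metis of_nat_mult of_nat_le_iff)
  qed
  have "n * 2 ^ (n - 1) = (\<Sum>m\<le>n. m * (n choose m))"
    by (simp add: choose_linear_sum)
  also have "\<dots> = (\<Sum>m=1..n. m * (n choose m))"
    by (rule sum.mono_neutral_right) auto
  also have "\<dots> \<le> (\<Sum>m=1..n. D)"
    using le by (intro sum_mono) auto
  finally show ?thesis using assms(1) by simp
qed

text \<open>
  The product of the largest prime powers not exceeding \<open>n\<close>, one for each prime, is a common multiple
  of \<open>1, \<dots>, n\<close>; it is at most \<open>n\<close> to the number of its factors.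
\<close>

lemma two_power_le_power_card_primes:
  fixes n :: nat
  assumes "1 \<le> n"
  shows "2 ^ (n - 1) \<le> n ^ card {p. prime p \<and> p \<le> n}"
proof -
  let ?P = "{p. prime p \<and> p \<le> n}"
  have fin: "finite ?P" by simp
  have "\<forall>p\<in>?P. \<exists>e. p ^ e \<le> n \<and> n < p ^ (e + 1)"
    using assms by (intro ballI ex_power_ivl1) (auto dest: prime_ge_2_nat)
  then obtain e where e: "p ^ e p \<le> n" "n < p ^ (e p + 1)" if "p \<in> ?P" for p
    by metis
  define D where "D = (\<Prod>p\<in>?P. p ^ e p)"
  have "i dvd D" if i: "1 \<le> i" "i \<le> n" for i
  proof -
    have sub: "prime_factors i \<subseteq> ?P"
      using i by (auto simp: prime_factors_dvd dest: dvd_imp_le)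
    have "p ^ multiplicity p i dvd p ^ e p" if p: "p \<in> prime_factors i" for p
    proof -
      have "p ^ multiplicity p i \<le> i"
        using i by (intro dvd_imp_le multiplicity_dvd) auto
      also have "\<dots> < p ^ (e p + 1)" using e(2)[of p] p sub i by auto
      finally have "multiplicity p i < e p + 1"
        using p by (metis in_prime_factors_iff prime_gt_1_nat power_less_imp_less_exp)
      then show ?thesis by (intro le_imp_power_dvd) simp
    qed
    then have "(\<Prod>p\<in>prime_factors i. p ^ multiplicity p i) dvd (\<Prod>p\<in>prime_factors i. p ^ e p)"
      by (rule prod_dvd_prod)
    also have "\<dots> dvd D"
      unfolding D_def by (rule prod_dvd_prod_subset[OF fin sub])
    finally show ?thesis
      using i prime_factorization_nat[of i] by simp
  qed
  moreover have "D > 0"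
    unfolding D_def by (rule prod_pos) (auto dest: prime_gt_0_nat)
  ultimately have "2 ^ (n - 1) \<le> D"
    using common_multiple_ge_power_of_2 assms by blast
  also have "D \<le> (\<Prod>p\<in>?P. n)"
    unfolding D_def using e(1) by (intro prod_mono) auto
  finally show ?thesis by simp
qed

theorem card_primes_ge:
  fixes x :: real
  assumes "x \<ge> 2"
  shows "ln 2 / 3 * (x / ln x) \<le> card {p :: nat. prime p \<and> real p \<le> x}"
proof -
  define n where "n = nat \<lfloor>x\<rfloor>"
  have n: "n \<ge> 2" "real n \<le> x" "x < real n + 1"
    using assms unfolding n_def by linarith+
  have P: "{p :: nat. prime p \<and> real p \<le> x} = {p. prime p \<and> p \<le> n}"
    using assms by (auto simp: n_def le_nat_floor le_floor_iff nat_le_iff) linarith?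
  let ?c = "card {p. prime p \<and> p \<le> n}"
  have lnx: "ln x > 0" using assms by simp
  have "real (2 ^ (n - 1)) \<le> real (n ^ ?c)"
    using two_power_le_power_card_primes[of n] n by (simp only: of_nat_le_iff)
  then have "ln (2 ^ (n - 1) :: real) \<le> ln (real n ^ ?c)"
    using n by (subst ln_le_cancel_iff) auto
  then have "real (n - 1) * ln 2 \<le> ?c * ln (real n)"
    using n by (simp add: ln_realpow)
  also have "\<dots> \<le> ?c * ln x"
    using n by (intro mult_left_mono) auto
  finally have "real (n - 1) * ln 2 \<le> ?c * ln x" .
  moreover have "x / 3 * ln 2 \<le> real (n - 1) * ln 2"
    using n by (intro mult_right_mono) auto
  ultimately have "x / 3 * ln 2 \<le> ?c * ln x" by linarith
  then show ?thesis
    unfolding P using lnx by (simp add: field_simps)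
qed

section \<open>Residues without square differences\<close>

definition square_diff_free :: "int \<Rightarrow> int set \<Rightarrow> bool" where
  "square_diff_free N A \<longleftrightarrow> A \<subseteq> {0..<N} \<and>
     (\<forall>a\<in>A. \<forall>b\<in>A. a \<noteq> b \<longrightarrow> (\<forall>u. \<not> [u\<^sup>2 = a - b] (mod N)))"

text \<open>
  Two new lowest digits in base \<open>m\<close>: one from \<open>R\<close>, then an arbitrary one.
\<close>

definition add_digits :: "int \<Rightarrow> int set \<Rightarrow> int set \<Rightarrow> int set" where
  "add_digits m R A = (\<lambda>(r, b, a). r + m * b + m\<^sup>2 * a) ` (R \<times> {0..<m} \<times> A)"

lemma base_digit_eq_iff:
  fixes m :: int
  assumes "r \<in> {0..<m}" "s \<in> {0..<m}"
  shows "r + m * a = s + m * b \<longleftrightarrow> r = s \<and> a = b"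
proof
  assume *: "r + m * a = s + m * b"
  have "(r + m * a) mod m = (s + m * b) mod m" using * by simp
  then have "r = s" using assms by simp
  then show "r = s \<and> a = b" using * assms by auto
qed auto

lemma card_add_digits:
  assumes "R \<subseteq> {0..<m}" "0 < m"
  shows "card (add_digits m R A) = card R * nat m * card A"
proof -
  have "inj_on (\<lambda>(r, b, a). r + m * b + m\<^sup>2 * a) (R \<times> {0..<m} \<times> A)"
  proof (rule inj_onI, clarify)
    fix r b a r' b' a'
    assume rb: "r \<in> R" "b \<in> {0..<m}" "r' \<in> R" "b' \<in> {0..<m}"
      and eq: "r + m * b + m\<^sup>2 * a = r' + m * b' + m\<^sup>2 * a'"
    have "r + m * (b + m * a) = r' + m * (b' + m * a')"
      using eq by (simp add: algebra_simps power2_eq_square)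
    moreover have "r \<in> {0..<m}" "r' \<in> {0..<m}" using rb assms(1) by auto
    ultimately have "r = r' \<and> b + m * a = b' + m * a'"
      using base_digit_eq_iff by blast
    then show "r = r' \<and> (b, a) = (b', a')"
      using rb base_digit_eq_iff[of b m b' a a'] by simp
  qed
  then show ?thesis
    unfolding add_digits_def by (simp add: card_image card_cartesian_product)
qed

lemma squarefree_dvd_power2_imp_dvd:
  fixes m u :: "'a :: semiring_gcd"
  assumes m: "squarefree m" and dvd: "m dvd u\<^sup>2"
  shows "m dvd u"
proof -
  define g where "g = gcd m u"
  have "m \<noteq> 0" using m by auto
  then have g: "g \<noteq> 0" by (simp add: g_def)
  obtain m' u' where mu: "m = m' * g" "u = u' * g" "coprime m' u'"
    using gcd_coprime_exists[of m u] g unfolding g_def by auto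
  have "g * m' dvd g * (g * u'\<^sup>2)"
    using dvd unfolding mu by (simp add: power2_eq_square mult_ac)
  then have "m' dvd g * u'\<^sup>2" using g by simp
  then have "m' dvd g"
    using mu(3) by (simp add: coprime_dvd_mult_left_iff)
  then have "m'\<^sup>2 dvd m" unfolding mu(1) power2_eq_square by (intro mult_dvd_mono) simp_all
  then have "is_unit m'" by (rule squarefreeD[OF m])
  then show ?thesis unfolding mu by (simp add: mult_unit_dvd_iff')
qed

text \<open>
  If the lowest digits of two elements differ, reduction modulo \<open>m\<close> contradicts the choice of \<open>R\<close>.
  If they agree, then \<open>m\<close> divides \<open>u\<^sup>2\<close> and, being squarefree, \<open>u\<close>; so \<open>m\<^sup>2\<close> divides \<open>u\<^sup>2\<close>, which
  forces the second digits to agree as well. Dividing by \<open>m\<^sup>2\<close> then leads back to \<open>A\<close>.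
\<close>

lemma square_diff_free_add_digits:
  fixes m :: int
  assumes m: "squarefree m" "0 < m" and R: "square_diff_free m R" and A: "square_diff_free N A"
  shows "square_diff_free (m\<^sup>2 * N) (add_digits m R A)"
  unfolding square_diff_free_def
proof (intro conjI ballI impI allI notI)
  show "add_digits m R A \<subseteq> {0..<m\<^sup>2 * N}"
  proof
    fix y assume "y \<in> add_digits m R A"
    then obtain r b a where y: "y = r + m * b + m\<^sup>2 * a" "r \<in> R" "b \<in> {0..<m}" "a \<in> A"
      by (auto simp: add_digits_def)
    have r: "0 \<le> r" "r < m" and a: "0 \<le> a" "a + 1 \<le> N"
      using y R A by (force simp: square_diff_free_def)+
    have "m * (b + 1) \<le> m * m" using y m by (intro mult_left_mono) auto
    then have "r + m * b < m\<^sup>2"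
      using r by (simp add: power2_eq_square algebra_simps)
    moreover have "m\<^sup>2 * (a + 1) \<le> m\<^sup>2 * N" using a by (intro mult_left_mono) auto
    ultimately have "y < m\<^sup>2 * N" by (simp add: y algebra_simps)
    moreover have "0 \<le> y" using y r a m by simp
    ultimately show "y \<in> {0..<m\<^sup>2 * N}" by simp
  qed
next
  fix y y' u
  assume "y \<in> add_digits m R A" "y' \<in> add_digits m R A" and ne: "y \<noteq> y'"
    and sq: "[u\<^sup>2 = y - y'] (mod m\<^sup>2 * N)"
  then obtain r b a r' b' a' where
    y: "y = r + m * b + m\<^sup>2 * a" "r \<in> R" "b \<in> {0..<m}" "a \<in> A" and
    y': "y' = r' + m * b' + m\<^sup>2 * a'" "r' \<in> R" "b' \<in> {0..<m}" "a' \<in> A"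
    by (auto simp: add_digits_def)
  have sq2: "[u\<^sup>2 = y - y'] (mod m\<^sup>2)" using sq by (rule cong_dvd_modulus) simp
  have "[u\<^sup>2 = y - y'] (mod m)"
    using sq2 by (rule cong_dvd_modulus) (simp add: power2_eq_square)
  moreover have "y - y' = (r - r') + m * (b - b' + m * (a - a'))"
    by (simp add: y y' algebra_simps power2_eq_square)
  ultimately have "[u\<^sup>2 = r - r'] (mod m)"
    by (simp add: cong_def)
  then have r: "r = r'" using R y y' by (auto simp: square_diff_free_def)
  have "m dvd u\<^sup>2"
    using \<open>[u\<^sup>2 = r - r'] (mod m)\<close> r by (simp add: cong_0_iff)
  then have "m dvd u" using m(1) squarefree_dvd_power2_imp_dvd by blast
  then obtain v where v: "u = m * v" by auto
  have "m\<^sup>2 dvd y - y' - u\<^sup>2"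
    using sq2 by (metis cong_iff_dvd_diff cong_sym)
  moreover have "y - y' - u\<^sup>2 = m * (b - b') + m\<^sup>2 * (a - a' - v\<^sup>2)"
    by (simp add: y y' r v algebra_simps power2_eq_square)
  ultimately have "m * m dvd m * (b - b')"
    by (simp add: dvd_add_left_iff power2_eq_square mult.assoc)
  then have "m dvd b - b'" using m by simp
  then have b: "b = b'"
    using y y' by (metis atLeastLessThan_iff mod_eq_dvd_iff mod_pos_pos_trivial)
  have "y - y' = m\<^sup>2 * (a - a')" "u\<^sup>2 = m\<^sup>2 * v\<^sup>2"
    by (simp_all add: y y' r b v algebra_simps power2_eq_square)
  then have "[v\<^sup>2 = a - a'] (mod N)"
    using sq m by (simp add: cong_iff_dvd_diff flip: right_diff_distrib)
  moreover have "a \<noteq> a'" using ne y y' r b by auto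
  ultimately show False using A y y' by (auto simp: square_diff_free_def)
qed

lemma ex_square_diff_free_power:
  fixes m :: int
  assumes m: "squarefree m" "0 < m" and R: "square_diff_free m R"
  shows "\<exists>A. square_diff_free (m ^ (2 * k)) A \<and> card A = (card R * nat m) ^ k"
proof (induction k)
  case 0
  have "square_diff_free (m ^ (2 * 0)) {0}" by (simp add: square_diff_free_def)
  then show ?case by (intro exI[of _ "{0}"]) simp
next
  case (Suc k)
  then obtain A where A: "square_diff_free (m ^ (2 * k)) A" "card A = (card R * nat m) ^ k"
    by blast
  have "R \<subseteq> {0..<m}" using R by (simp add: square_diff_free_def)
  then have "card (add_digits m R A) = (card R * nat m) ^ Suc k"
    using card_add_digits[of R m A] m A by simp
  moreover have "square_diff_free (m ^ (2 * Suc k)) (add_digits m R A)"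
    using square_diff_free_add_digits[OF m R A(1)] by (simp add: power_add power2_eq_square mult.assoc)
  ultimately show ?case by blast
qed

text \<open>
  The set was found by a computer search for a clique in the graph on the residues modulo 205 that
  joins two residues when their difference is not a square. Since \<open>205 = 5 * 41\<close>, a number
  is a nonsquare modulo 205 as soon as it is one modulo 5 or modulo 41.
\<close>

definition residues_205 :: "int set" where
  "residues_205 = {0, 11, 54, 65, 83, 89, 117, 143, 161, 172, 187, 199}"

lemma card_residues_205: "card residues_205 = 12"
  by (simp add: residues_205_def)

lemma squarefree_205: "squarefree (205 :: int)"
proof -
  have "prime (5 :: nat)" "prime (41 :: nat)" by simp_all
  then have "prime (5 :: int)" "prime (41 :: int)"
    using prime_nat_int_transfer[of 5] prime_nat_int_transfer[of 41] by simp_all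
  then have "squarefree (5 :: int)" "squarefree (41 :: int)"
    by (simp_all add: squarefree_prime)
  moreover have "coprime (5 :: int) 41"
    by (simp add: primes_coprime)
  ultimately have "squarefree (5 * 41 :: int)"
    by (intro squarefree_mult_coprime)
  then show ?thesis by simp
qed

lemma square_mod_5: "(u :: int)\<^sup>2 mod 5 \<in> {0, 1, 4}"
proof -
  have "u mod 5 \<in> {0..<5}" by simp
  also have "{0..<5} = {0, 1, 2, 3, 4 :: int}" by auto
  finally have "(u mod 5)\<^sup>2 mod 5 \<in> {0, 1, 4}" by auto
  then show ?thesis by (simp add: power_mod)
qed

definition squares_41 :: "int set" where
  "squares_41 = {0, 1, 2, 4, 5, 8, 9, 10, 16, 18, 20, 21, 23, 25, 31, 32, 33, 36, 37, 39, 40}"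

text \<open>
  The upper half of the residues is reduced to the lower one by \<open>u\<^sup>2 = (- u)\<^sup>2\<close>.
\<close>

lemma square_mod_41: "(u :: int)\<^sup>2 mod 41 \<in> squares_41"
proof -
  have small: "v\<^sup>2 mod 41 \<in> squares_41" if "v \<in> {0..20}" for v :: int
  proof -
    have "{0..20} = {0, 1, 2, 3, 4, 5, 6, 7, 8, 9, 10, 11, 12, 13, 14, 15, 16, 17, 18, 19, 20 :: int}"
      by (simp add: upto.simps flip: set_upto)
    then show ?thesis using that by (auto simp: squares_41_def)
  qed
  define w where "w = u mod 41"
  have w: "0 \<le> w" "w < 41" by (simp_all add: w_def)
  have "w\<^sup>2 mod 41 \<in> squares_41"
  proof (cases "w \<le> 20")
    case True
    then show ?thesis using small w by simp
  next
    case False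
    have "(41 - w)\<^sup>2 = w\<^sup>2 + 41 * (41 - 2 * w)"
      by (simp add: power2_eq_square algebra_simps)
    then have "(41 - w)\<^sup>2 mod 41 = w\<^sup>2 mod 41" by (simp only: mod_mult_self2)
    then show ?thesis using small[of "41 - w"] w False by simp
  qed
  then show ?thesis by (simp add: w_def power_mod)
qed

text \<open>
  This predicate stays folded while the pairs of residues are enumerated, so that its remainders are
  only computed for concrete differences.
\<close>

definition nonsquare_mod_5_or_41 :: "int \<Rightarrow> bool" where
  "nonsquare_mod_5_or_41 d \<longleftrightarrow> d mod 5 \<notin> {0, 1, 4} \<or> d mod 41 \<notin> squares_41"

lemma residues_205_nonsquare:
  "\<forall>a\<in>residues_205. \<forall>b\<in>residues_205. a \<noteq> b \<longrightarrow> nonsquare_mod_5_or_41 (a - b)"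
  by (simp add: residues_205_def) (simp add: nonsquare_mod_5_or_41_def squares_41_def)

lemma square_diff_free_residues_205: "square_diff_free 205 residues_205"
  unfolding square_diff_free_def
proof (intro conjI ballI impI allI notI)
  show "residues_205 \<subseteq> {0..<205}" by (simp add: residues_205_def)
next
  fix a b u :: int
  assume ab: "a \<in> residues_205" "b \<in> residues_205" "a \<noteq> b" and sq: "[u\<^sup>2 = a - b] (mod 205)"
  have "[u\<^sup>2 = a - b] (mod 5)" "[u\<^sup>2 = a - b] (mod 41)"
    using cong_dvd_modulus[OF sq] by simp_all
  then have "(a - b) mod 5 \<in> {0, 1, 4}" "(a - b) mod 41 \<in> squares_41"
    using square_mod_5[of u] square_mod_41[of u] by (simp_all only: cong_def)
  then have "\<not> nonsquare_mod_5_or_41 (a - b)"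
    by (simp only: nonsquare_mod_5_or_41_def) simp
  then show False using ab residues_205_nonsquare by blast
qed

section \<open>Averaging over translates\<close>

text \<open>
  Each element of \<open>P\<close> lies in exactly \<open>card A\<close> of the \<open>N\<close> translates of \<open>A\<close> modulo \<open>N\<close>, so on average
  a translate contains \<open>card P * card A / N\<close> elements of \<open>P\<close>.
\<close>

lemma ex_translate_meeting_many:
  fixes P A :: "int set" and N :: int
  assumes "finite P" "0 < N" "A \<subseteq> {0..<N}"
  shows "\<exists>t. card P * card A \<le> nat N * card {p \<in> P. (p - t) mod N \<in> A}"
proof (rule ccontr)
  let ?T = "{0..<N}"
  assume "\<not> ?thesis"
  then have lt: "nat N * card {p \<in> P. (p - t) mod N \<in> A} < card P * card A" for t
    by (simp add: not_le)
  have count: "card {t \<in> ?T. (p - t) mod N \<in> A} = card A" for p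
  proof (rule bij_betw_same_card)
    \<comment> \<open>The reflection \<open>t \<mapsto> p - t\<close> modulo \<open>N\<close> is its own inverse.\<close>
    have inv: "(p - (p - s) mod N) mod N = s" if "s \<in> ?T" for s
      using that by (simp add: mod_diff_right_eq)
    show "bij_betw (\<lambda>t. (p - t) mod N) {t \<in> ?T. (p - t) mod N \<in> A} A"
    proof (rule bij_betw_byWitness[where f' = "\<lambda>a. (p - a) mod N"])
      show "(\<lambda>a. (p - a) mod N) ` A \<subseteq> {t \<in> ?T. (p - t) mod N \<in> A}"
        using inv assms(2,3) by (auto simp: subset_iff)
    qed (use inv assms(3) in auto)
  qed
  have "nat N * (\<Sum>t\<in>?T. card {p \<in> P. (p - t) mod N \<in> A})
      = (\<Sum>t\<in>?T. nat N * card {p \<in> P. (p - t) mod N \<in> A})"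
    by (rule sum_distrib_left)
  also have "\<dots> < (\<Sum>t\<in>?T. card P * card A)"
    using lt assms(2) by (intro sum_strict_mono) auto
  also have "\<dots> = nat N * (card P * card A)" by simp
  also have "card P * card A = (\<Sum>p\<in>P. card {t \<in> ?T. (p - t) mod N \<in> A})"
    by (simp only: count sum_constant) simp
  also have "\<dots> = (\<Sum>t\<in>?T. card {p \<in> P. (p - t) mod N \<in> A})"
    using assms(1) by (intro sum_multicount_gen[symmetric]) auto
  finally show False by simp
qed

lemma ex_subset_no_square_diff:
  fixes P :: "nat set" and N :: int
  assumes N: "0 < N" and P: "finite P" "inj_on (\<lambda>p. int p mod N) P"
    and A: "square_diff_free N A"
  shows "\<exists>S\<subseteq>P. card P * card A \<le> nat N * card S \<and>
           (\<forall>p\<in>S. \<forall>q\<in>S. p \<noteq> q \<longrightarrow> \<not> is_square (int p - int q))"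
proof -
  obtain t where t: "card (int ` P) * card A \<le> nat N * card {p \<in> int ` P. (p - t) mod N \<in> A}"
    using ex_translate_meeting_many[of "int ` P" N A] N P A by (auto simp: square_diff_free_def)
  define S where "S = {p \<in> P. (int p - t) mod N \<in> A}"
  have "{p \<in> int ` P. (p - t) mod N \<in> A} = int ` S" by (auto simp: S_def)
  then have "card P * card A \<le> nat N * card S" using t by (simp add: card_image)
  moreover have "\<not> is_square (int p - int q)" if pq: "p \<in> S" "q \<in> S" "p \<noteq> q" for p q
  proof
    assume "is_square (int p - int q)"
    then obtain u where u: "int p - int q = u\<^sup>2" by (auto elim: is_nth_powerE)
    let ?a = "(int p - t) mod N" and ?b = "(int q - t) mod N"
    have "[?a - ?b = (int p - t) - (int q - t)] (mod N)"
      by (intro cong_diff) simp_all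
    then have "[u\<^sup>2 = ?a - ?b] (mod N)"
      using u by (simp add: cong_sym_eq)
    moreover have "?a \<noteq> ?b"
    proof
      assume "?a = ?b"
      then have "[int p - t = int q - t] (mod N)" by (simp add: cong_def)
      then have "[int p - t + t = int q - t + t] (mod N)" by (intro cong_add) simp_all
      then have "int p mod N = int q mod N" by (simp add: cong_def)
      then show False using P(2) pq by (auto simp: S_def inj_on_def)
    qed
    ultimately show False using A pq by (auto simp: S_def square_diff_free_def)
  qed
  ultimately show ?thesis by (intro exI[of _ S]) (auto simp: S_def)
qed

section \<open>The density of the residues and the exponent\<close>

text \<open>
  With \<open>N = 205 ^ (2 * k)\<close> the density \<open>(12 / 205) ^ k\<close> of the residues is \<open>N powr (\<gamma> - 1)\<close>, because
  \<open>2 * ln 205 * (\<gamma> - 1) = ln (12 / 205)\<close>.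
\<close>

lemma powr_gamma_exponent_le:
  fixes x :: real
  assumes x: "205 ^ (2 * k) \<le> x"
  shows "x powr gamma_exponent \<le> x * (12 / 205) ^ k"
proof -
  have ln205: "ln (205 :: real) > 0" by simp
  have "(0 :: real) < 205 ^ (2 * k)" by simp
  then have x0: "x > 0" using x by linarith
  have "gamma_exponent < 1" using gamma_exponent_decimals by simp
  have "x powr (gamma_exponent - 1) \<le> (205 ^ (2 * k)) powr (gamma_exponent - 1)"
    using x \<open>gamma_exponent < 1\<close> by (intro powr_mono2') auto
  also have "\<dots> = exp (real k * (2 * ln 205 * (gamma_exponent - 1)))"
    by (simp add: powr_def ln_realpow algebra_simps)
  also have "2 * ln 205 * (gamma_exponent - 1) = ln (12 / 205)"
    using ln205 by (simp add: gamma_exponent_def ln_div field_simps)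
  also have "exp (real k * ln (12 / 205)) = (12 / 205) ^ k"
    by (simp add: exp_of_nat_mult)
  finally have "x * x powr (gamma_exponent - 1) \<le> x * (12 / 205) ^ k"
    using x0 by simp
  then show ?thesis using x0 by (simp add: powr_diff)
qed

theorem theorem5:
  fixes x :: real
  assumes "x \<ge> 2"
  shows "\<exists>S :: nat set.
    S \<subseteq> {p. prime p \<and> real p \<le> x} \<and>
    real (card S) \<ge> 1 / 205 * (x powr gamma_exponent / ln x) \<and>
    (\<forall>p\<in>S. \<forall>q\<in>S. p \<noteq> q \<longrightarrow> \<not> is_square (int p - int q))"
proof -
  let ?P = "{p :: nat. prime p \<and> real p \<le> x}"
  have lnx: "ln x > 0" using assms by simp
  \<comment> \<open>The exponent of the least power of \<open>205\<^sup>2\<close> that is at least \<open>x\<close> (rounded down) is \<open>Suc k\<close>. The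
    bound \<open>205 ^ (2 * k) \<le> x\<close> for its predecessor controls the density.\<close>
  have "2 \<le> nat \<lfloor>x\<rfloor>" using assms by linarith
  then obtain k where k: "(205\<^sup>2) ^ k < nat \<lfloor>x\<rfloor>" "nat \<lfloor>x\<rfloor> \<le> (205\<^sup>2) ^ (k + 1)"
    using ex_power_ivl2[of "205\<^sup>2" "nat \<lfloor>x\<rfloor>"] by auto
  define N :: int where "N = 205 ^ (2 * Suc k)"
  have N: "0 < N" by (simp add: N_def)
  have "int (nat \<lfloor>x\<rfloor>) \<le> int ((205\<^sup>2) ^ (k + 1))" using k(2) by (simp only: of_nat_le_iff)
  then have "\<lfloor>x\<rfloor> \<le> N" using assms by (simp add: N_def power_mult)
  have "real ((205\<^sup>2) ^ k) \<le> real (nat \<lfloor>x\<rfloor>)" using k(1) by (simp only: of_nat_le_iff)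
  also have "\<dots> \<le> x" using assms by simp
  finally have kx: "205 ^ (2 * k) \<le> x" by (simp add: power_mult)
  have P_range: "0 < p" "int p \<le> N" if "p \<in> ?P" for p
  proof -
    show "0 < p" using that by (simp add: prime_gt_0_nat)
    have "int p \<le> \<lfloor>x\<rfloor>" using that by (simp add: le_floor_iff)
    then show "int p \<le> N" using \<open>\<lfloor>x\<rfloor> \<le> N\<close> by simp
  qed
  have fin: "finite ?P"
    by (rule finite_subset[of _ "{..nat N}"]) (use P_range(2) N in \<open>auto simp: le_nat_iff\<close>)
  have inj: "inj_on (\<lambda>p. int p mod N) ?P"
  proof (rule inj_onI)
    fix p q assume pq: "p \<in> ?P" "q \<in> ?P" "int p mod N = int q mod N"
    \<comment> \<open>The primes lie in \<open>{1..N}\<close>, so a shift by 1 turns them into their own remainders.\<close>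
    then have "(int p - 1) mod N = (int q - 1) mod N" by (metis mod_diff_left_eq)
    moreover have "(int p - 1) mod N = int p - 1" "(int q - 1) mod N = int q - 1"
      using P_range[of p] P_range[of q] pq by simp_all
    ultimately show "p = q" by simp
  qed
  obtain A where A: "square_diff_free N A" "card A = (12 * 205) ^ Suc k"
    using ex_square_diff_free_power[OF squarefree_205 _ square_diff_free_residues_205, of "Suc k"]
    unfolding N_def card_residues_205 by auto
  obtain S where S: "S \<subseteq> ?P" "card ?P * card A \<le> nat N * card S"
      "\<forall>p\<in>S. \<forall>q\<in>S. p \<noteq> q \<longrightarrow> \<not> is_square (int p - int q)"
    using ex_subset_no_square_diff[OF N fin inj A(1)] by auto
  have "N = int (205 ^ (2 * Suc k))" by (simp only: N_def of_nat_power of_nat_numeral)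
  then have "nat N = 205 ^ (2 * Suc k)" by (simp only: nat_int)
  then have "card ?P * (12 * 205) ^ Suc k \<le> 205 ^ (2 * Suc k) * card S"
    using S(2) by (simp only: A)
  also have "(205 :: nat) ^ (2 * Suc k) = 205 ^ Suc k * 205 ^ Suc k"
    by (simp only: mult_2 power_add)
  finally have "205 ^ Suc k * (card ?P * 12 ^ Suc k) \<le> 205 ^ Suc k * (205 ^ Suc k * card S)"
    by (simp only: power_mult_distrib mult_ac)
  then have "card ?P * 12 ^ Suc k \<le> 205 ^ Suc k * card S"
    by (subst (asm) mult_le_cancel1) simp
  then have "real (card ?P * 12 ^ Suc k) \<le> real (205 ^ Suc k * card S)"
    by (simp only: of_nat_le_iff)
  then have cardS: "real (card ?P) * (12 / 205) ^ Suc k \<le> real (card S)"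
    by (simp add: power_divide field_simps)
  have "ln (2 :: real) \<ge> 1 / 4"
    using ln2_ge_two_thirds by simp
  \<comment> \<open>One factor \<open>12 / 205\<close> is split off since \<open>x\<close> is only compared with \<open>205 ^ (2 * k)\<close>; this is where
    the constant \<open>1 / 205\<close> comes from.\<close>
  have "1 / 205 * (x powr gamma_exponent / ln x)
      \<le> (12 / 205 * (ln 2 / 3)) * (x * (12 / 205) ^ k / ln x)"
    using powr_gamma_exponent_le[OF kx] lnx assms \<open>ln (2 :: real) \<ge> 1 / 4\<close>
    by (intro mult_mono divide_right_mono) auto
  also have "\<dots> = (ln 2 / 3 * (x / ln x)) * (12 / 205) ^ Suc k"
    by (simp add: mult_ac)
  also have "\<dots> \<le> real (card ?P) * (12 / 205) ^ Suc k"
    by (intro mult_right_mono card_primes_ge assms) simp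
  also have "\<dots> \<le> real (card S)" by (rule cardS)
  finally show ?thesis using S(1,3) by blast
qed

end
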